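(* Let $K\subset\mathbb{R}^n$ be a symmetric convex body and let $f$ be a probability density on $\mathbb{R}^n$ with support $K$ (that is, $f>0$ almost everywhere on $K$ and $f=0$ almost everywhere outside $K$). Then $$C_{-1}(f)=(2K)^\circ=(R_\infty(f))^\circ .$$
   Context: A convex body is a compact convex set with nonempty interior; it is symmetric if $K=-K$. Write $2K=\{2x:x\in K\}$, and for a set $L$ let $L^\circ=\{y\in\mathbb{R}^n: x\cdot y\le 1\ \text{for all } x\in L\}$ be its polar. The set with radial function $\rho:\mathbb{S}^{n-1}\to[0,\infty)$ is $\{rv: v\in\mathbb{S}^{n-1},\ 0\le r\le\rho(v)\}$. For a probability density $f$ on $\mathbb{R}^n$ and nonzero real $p$, the $p$-th cross-section body $C_p(f)$ is the set with radial function $$\rho_{C_p(f)}(v)=\left(\int_{\mathbb{R}^n}\Big(\int_{x+v^\perp}f(y)\,dy\Big)^p f(x)\,dx\right)^{1/p},\quad v\in\mathbb{S}^{n-1},$$ where $v^\perp$ is the hyperplane through the origin orthogonal to $v$, and the inner integral is with respect to $(n-1)$-dimensional Lebesgue measure. Equivalently, $\rho_{C_p(f)}(v)=\left(\int_{\mathbb{R}}\big(\int_{x\cdot v=t}f(x)\,dx\big)^{p+1}dt\right)^{1/p}$, where for $p=-1$ the outer integral is the Lebesgue measure of $\{t:\int_{x\cdot v=t}f>0\}$. For $p>0$ the $p$-th radial mean body $R_p(f)$ is the set with radial function $$\rho_{R_p(f)}(v)=\left(\int_{\mathbb{R}^n}f(x)\int_0^\infty r^{p-1}f(x+rv)\,dr\,dx\right)^{1/p},\quad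 v\in\mathbb{S}^{n-1}.$$ For $p=\infty$ this is understood in the usual $L^\infty$ sense: $\rho_{R_\infty(f)}(v)$ is the essential supremum of the function $(x,r)\mapsto r$ on $\mathbb{R}^n\times(0,\infty)$ with respect to the measure $f(x)f(x+rv)\,dx\,dr$. *)

theory Defs
  imports "HOL-Analysis.Analysis" "HOL-Probability.Essential_Supremum"
begin

definition convex_body :: "'a::euclidean_space set \<Rightarrow> bool" where
  "convex_body K \<longleftrightarrow> compact K \<and> convex K \<and> interior K \<noteq> {}"

definition symmetric_set :: "'a::euclidean_space set \<Rightarrow> bool" where
  "symmetric_set K \<longleftrightarrow> uminus ` K = K"

definition polar :: "'a::euclidean_space set \<Rightarrow> 'a set" where
  "polar L = {y. \<forall>x\<in>L. x \<bullet> y \<le> 1}"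

text \<open>Densities are Lebesgue (not necessarily Borel) measurable.\<close>

definition probability_density :: "('a::euclidean_space \<Rightarrow> real) \<Rightarrow> bool" where
  "probability_density f \<longleftrightarrow>
     f \<in> borel_measurable lebesgue \<and> (\<forall>x. 0 \<le> f x) \<and> (\<integral>\<^sup>+ x. ennreal (f x) \<partial>lebesgue) = 1"

definition density_support :: "('a::euclidean_space \<Rightarrow> real) \<Rightarrow> 'a set \<Rightarrow> bool" where
  "density_support f K \<longleftrightarrow>
     (AE x in lebesgue. x \<in> K \<longrightarrow> f x > 0) \<and> (AE x in lebesgue. x \<notin> K \<longrightarrow> f x = 0)"

text \<open>Radial functions take values in \<^typ>\<open>ennreal\<close>, so that no convention is needed
  for directions in which a defining integral or essential supremum is infinite.\<close>

definition radial_set :: "('a::euclidean_space \<Rightarrow> ennreal) \<Rightarrow> 'a set" where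
  "radial_set \<rho> = {r *\<^sub>R v | r v. norm v = 1 \<and> 0 \<le> r \<and> ennreal r \<le> \<rho> v}"

text \<open>Real powers on \<open>[0, \<infinity>]\<close>, for non-zero exponents; in particular
  \<open>0\<close> and \<open>\<infinity>\<close> are swapped by negative exponents.\<close>

definition ennpow :: "ennreal \<Rightarrow> real \<Rightarrow> ennreal" where
  "ennpow a p =
     (if a = \<infinity> then (if p < 0 then 0 else \<infinity>)
      else if a = 0 \<and> p < 0 then \<infinity>
      else ennreal (enn2real a powr p))"

lemma ennpow_minus_one: "ennpow a (- 1) = inverse a"
proof (cases a)
  case (real r)
  then show ?thesis
    by (cases "r = 0") (auto simp: ennpow_def powr_minus inverse_ennreal)
qed (simp add: ennpow_def)

definition orthonormal_basis_of :: "'a::euclidean_space set \<Rightarrow> 'a set \<Rightarrow> bool" where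
  "orthonormal_basis_of S B \<longleftrightarrow>
     pairwise orthogonal B \<and> (\<forall>b\<in>B. norm b = 1) \<and> span B = S"

lemma orthonormal_basis_of_exists:
  assumes "subspace S"
  shows "\<exists>B. orthonormal_basis_of S B"
  using orthonormal_basis_subspace[OF assms] unfolding orthonormal_basis_of_def by metis

text \<open>The \<open>dim S\<close>-dimensional Lebesgue measure on a linear subspace \<open>S\<close>, regarded as a
  measure on the ambient space: the construction of \<^const>\<open>lborel\<close>, with \<open>Basis\<close> replaced by an
  orthonormal basis of \<open>S\<close>. By rotation invariance of Lebesgue measure the result does not depend
  on the basis chosen. It is defined on the Borel sets; \<^const>\<open>nn_integral\<close> does not change under
  completion of the measure. On the trivial subspace it is the unit mass at \<open>0\<close>.\<close>

definition subspace_lborel :: "'a::euclidean_space set \<Rightarrow> 'a measure" where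
  "subspace_lborel S =
     (let B = (SOME B. orthonormal_basis_of S B)
      in distr (\<Pi>\<^sub>M b\<in>B. (lborel :: real measure)) borel (\<lambda>c. \<Sum>b\<in>B. c b *\<^sub>R b))"

text \<open>The integral of \<open>f\<close> over the affine hyperplane through \<open>x\<close> orthogonal to \<open>v\<close>.\<close>

definition hyperplane_integral ::
    "('a::euclidean_space \<Rightarrow> real) \<Rightarrow> 'a \<Rightarrow> 'a \<Rightarrow> ennreal" where
  "hyperplane_integral f v x = (\<integral>\<^sup>+ y. ennreal (f (x + y)) \<partial>subspace_lborel {y. v \<bullet> y = 0})"

definition cross_section_body :: "real \<Rightarrow> ('a::euclidean_space \<Rightarrow> real) \<Rightarrow> 'a set" where
  "cross_section_body p f =
     radial_set (\<lambda>v. ennpow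
       (\<integral>\<^sup>+ x. ennpow (hyperplane_integral f v x) p * ennreal (f x) \<partial>lebesgue) (1 / p))"

definition radial_mean_body_infinity :: "('a::euclidean_space \<Rightarrow> real) \<Rightarrow> 'a set" where
  "radial_mean_body_infinity f =
     radial_set (\<lambda>v. esssup
       (density (lebesgue_on (UNIV \<times> {0<..})) (\<lambda>(x, r). ennreal (f x * f (x + r *\<^sub>R v))))
       (\<lambda>(x, r). ennreal r))"

end

theory Submission
  imports Defs
begin

text \<open>
  Fix a unit vector \<open>v\<close> and let \<open>\<phi> t\<close> be the integral of \<open>f\<close> over the hyperplane
  \<open>x \<bullet> v = t\<close>. By Fubini along \<open>v\<close> the integral defining \<open>C_{-1}(f)\<close> equals
  \<open>\<integral> \<phi> t / \<phi> t dt\<close>, the length of \<open>{t. \<phi> t > 0}\<close>. That set is, up to a null set, the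
  projection of \<open>K\<close> on the line through \<open>v\<close>, so the radial function is the reciprocal of the
  width of \<open>K\<close>, which by symmetry is twice its support function. On the other hand,
  the radial function of \<open>R_\<infinity>(f)\<close> at \<open>v\<close> is the length of the longest chord of \<open>K\<close> parallel to
  \<open>v\<close>; averaging a chord with its reflection shows that the maximum is attained through the origin,
  whence \<open>R_\<infinity>(f) = 2K\<close>.
\<close>

section \<open>Lebesgue measure in orthonormal coordinates\<close>

lemma nn_integral_lborel_translate:
  fixes f :: "'a::euclidean_space \<Rightarrow> ennreal"
  assumes [measurable]: "f \<in> borel_measurable borel"
  shows "(\<integral>\<^sup>+ x. f (a + x) \<partial>lborel) = (\<integral>\<^sup>+ x. f x \<partial>lborel)"
  by (subst (2) lborel_distr_plus[of a, symmetric]) (simp add: nn_integral_distr)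

text \<open>Uniqueness of the translation-invariant measure: Fubini for \<open>indicator A (y + T x) * indicator B y\<close>
  gives the identity up to the measure of the unit ball \<open>B\<close>, which \<open>T\<close> preserves. The statement
  \<open>measure_orthogonal_image\<close> of the library needs a well-ordered index type.\<close>

lemma distr_lborel_orthogonal_transformation:
  fixes T :: "'a::euclidean_space \<Rightarrow> 'a"
  assumes T: "orthogonal_transformation T"
  shows "distr lborel borel T = lborel"
proof (rule measure_eqI)
  fix A assume "A \<in> sets (distr lborel borel T)"
  then have [measurable]: "A \<in> sets borel"
    by simp
  have [measurable]: "T \<in> borel_measurable borel"
    using T by (intro borel_measurable_continuous_onI)
      (simp add: linear_continuous_on linear_linear orthogonal_transformation_linear)
  define B where "B = ball (0 :: 'a) 1"
  have [measurable]: "B \<in> sets borel"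
    by (simp add: B_def)
  have Tinv: "T (inv T y + x) = y + T x" "T (x + inv T y) = T x + y" for x y
    using T by (simp_all add: linear_add orthogonal_transformation_linear orthogonal_transformation_surj surj_f_inv_f)
  \<comment> \<open>Shifting \<open>x\<close> by \<open>inv T y\<close> turns \<open>y - T x\<close>
    into \<open>- T x\<close>, whose norm is that of \<open>x\<close>; so membership in the ball
    \<open>B\<close> no longer involves \<open>T\<close> or \<open>y\<close>.\<close>
  have key: "(\<integral>\<^sup>+ x. indicator B (y - T x) \<partial>lborel) = (\<integral>\<^sup>+ x. indicator B x \<partial>(lborel :: 'a measure))" for y
  proof -
    have "(\<integral>\<^sup>+ x. indicator B (y - T x) \<partial>lborel) = (\<integral>\<^sup>+ x. indicator B (y - T (inv T y + x)) \<partial>lborel)"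
      by (rule nn_integral_lborel_translate[symmetric]) simp
    also have "\<dots> = (\<integral>\<^sup>+ x. indicator B x \<partial>lborel)"
      using T by (simp add: Tinv B_def indicator_def orthogonal_transformation_norm)
    finally show ?thesis .
  qed
  have "emeasure (distr lborel borel T) A * emeasure lborel B
      = (\<integral>\<^sup>+ y. (\<integral>\<^sup>+ x. indicator A (T x) \<partial>lborel) * indicator B y \<partial>lborel)"
    by (simp add: nn_integral_cmult nn_integral_distr flip: nn_integral_indicator)
  \<comment> \<open>For each fixed \<open>y\<close>, translating \<open>x\<close> by
    \<open>inv T y\<close> inserts \<open>y\<close> inside the indicator of \<open>A\<close> without
    changing the inner integral. This couples the two factors, so that exchanging the integrals can
    move \<open>T\<close> from \<open>A\<close> to \<open>B\<close>.\<close>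
  also have "\<dots> = (\<integral>\<^sup>+ y. (\<integral>\<^sup>+ x. indicator A (y + T x) * indicator B y \<partial>lborel) \<partial>lborel)"
    by (intro nn_integral_cong, subst nn_integral_lborel_translate[of _ "inv T _", symmetric])
       (simp_all add: nn_integral_multc Tinv)
  also have "\<dots> = (\<integral>\<^sup>+ x. (\<integral>\<^sup>+ y. indicator A (y + T x) * indicator B y \<partial>lborel) \<partial>lborel)"
    by (rule lborel_pair.Fubini') simp
  also have "\<dots> = (\<integral>\<^sup>+ x. (\<integral>\<^sup>+ y. indicator A y * indicator B (y - T x) \<partial>lborel) \<partial>lborel)"
  proof (rule nn_integral_cong)
    fix x
    show "(\<integral>\<^sup>+ y. indicator A (y + T x) * indicator B y \<partial>lborel) = (\<integral>\<^sup>+ y. indicator A y * indicator B (y - T x) \<partial>lborel)"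
      using nn_integral_lborel_translate[of "\<lambda>y. indicator A y * indicator B (y - T x)" "T x"]
      by (simp add: add.commute)
  qed
  also have "\<dots> = (\<integral>\<^sup>+ y. (\<integral>\<^sup>+ x. indicator A y * indicator B (y - T x) \<partial>lborel) \<partial>lborel)"
    by (rule lborel_pair.Fubini'[symmetric]) simp
  also have "\<dots> = (\<integral>\<^sup>+ y. indicator A y * (\<integral>\<^sup>+ x. indicator B (y - T x) \<partial>lborel) \<partial>lborel)"
    by (simp add: nn_integral_cmult)
  also have "\<dots> = (\<integral>\<^sup>+ y. indicator A y * (\<integral>\<^sup>+ x. indicator B x \<partial>lborel) \<partial>lborel)"
    by (simp only: key)
  also have "\<dots> = emeasure lborel A * emeasure lborel B"
    by (simp add: nn_integral_multc)
  finally have eq: "emeasure (distr lborel borel T) A * emeasure lborel B = emeasure lborel A * emeasure lborel B" .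
  have "emeasure lborel B \<noteq> 0"
    using open_not_negligible[of B] by (auto simp: B_def negligible_iff_null_sets null_sets_def)
  moreover have "emeasure lborel B \<noteq> \<infinity>"
    using emeasure_lborel_ball_finite[of 0 1] by (simp add: B_def less_top)
  ultimately show "emeasure (distr lborel borel T) A = emeasure lborel A"
    using eq by (auto simp: mult.commute[of _ "emeasure lborel B"] ennreal_mult_cancel_left)
qed simp

text \<open>Boxes pull back to boxes whose sides are translates of the original ones, so box volumes
  agree, and these determine the product measure. Zero shifts serve for a change of orthonormal
  basis; the identity reindexing serves for translation invariance within a subspace.\<close>

lemma distr_PiM_lborel_reindex_translate:
  fixes c :: "'j \<Rightarrow> real"
  assumes "finite I" and p: "bij_betw p I J"
  shows "distr (\<Pi>\<^sub>M i\<in>I. lborel) (\<Pi>\<^sub>M j\<in>J. lborel) (\<lambda>x. \<lambda>j\<in>J. c j + x (inv_into I p j))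
    = (\<Pi>\<^sub>M j\<in>J. lborel)"
proof (rule product_sigma_finite.PiM_eqI)
  interpret product_sigma_finite "\<lambda>_. lborel :: real measure" by standard
  show "product_sigma_finite (\<lambda>_. lborel :: real measure)" by standard
  show "finite J"
    using assms bij_betw_finite by blast
  fix A :: "'j \<Rightarrow> real set" assume A: "\<And>j. j \<in> J \<Longrightarrow> A j \<in> sets lborel"
  have pI: "p i \<in> J" "inv_into I p (p i) = i" if "i \<in> I" for i
    using that p by (auto simp: bij_betw_def)
  have pJ: "inv_into I p j \<in> I" "p (inv_into I p j) = j" if "j \<in> J" for j
    using that p by (auto simp: bij_betw_def inv_into_into f_inv_into_f)
  let ?f = "\<lambda>x. \<lambda>j\<in>J. c j + x (inv_into I p j)"
  have [measurable]: "?f \<in> (\<Pi>\<^sub>M i\<in>I. lborel) \<rightarrow>\<^sub>M (\<Pi>\<^sub>M j\<in>J. lborel)"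
    using pJ by (intro measurable_restrict) measurable
  have pre: "?f -` Pi\<^sub>E J A \<inter> space (\<Pi>\<^sub>M i\<in>I. lborel)
      = Pi\<^sub>E I (\<lambda>i. (\<lambda>t. c (p i) + t) -` A (p i))"
  proof -
    have "J = p ` I"
      using p by (simp add: bij_betw_def)
    then show ?thesis
      using pI by (auto simp: space_PiM PiE_iff)
  qed
  have tr: "(\<lambda>t. c (p i) + t) -` A (p i) \<in> sets borel"
    "emeasure lborel ((\<lambda>t. c (p i) + t) -` A (p i)) = emeasure lborel (A (p i))" if "i \<in> I" for i
  proof -
    have [measurable]: "A (p i) \<in> sets borel"
      using A pI that by simp
    show "(\<lambda>t. c (p i) + t) -` A (p i) \<in> sets borel"
      using measurable_sets[of "\<lambda>t. c (p i) + t" borel borel "A (p i)"] by simp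
    have "emeasure lborel (A (p i)) = emeasure (distr lborel borel (\<lambda>t. c (p i) + t)) (A (p i))"
      by (simp add: lborel_distr_plus)
    then show "emeasure lborel ((\<lambda>t. c (p i) + t) -` A (p i)) = emeasure lborel (A (p i))"
      by (simp add: emeasure_distr)
  qed
  have "emeasure (distr (\<Pi>\<^sub>M i\<in>I. lborel) (\<Pi>\<^sub>M j\<in>J. lborel) ?f) (Pi\<^sub>E J A)
      = emeasure (\<Pi>\<^sub>M i\<in>I. lborel) (Pi\<^sub>E I (\<lambda>i. (\<lambda>t. c (p i) + t) -` A (p i)))"
    using A \<open>finite J\<close> by (subst emeasure_distr) (auto simp: pre intro!: sets_PiM_I_finite)
  also have "\<dots> = (\<Prod>i\<in>I. emeasure lborel (A (p i)))"
    using \<open>finite I\<close> tr by (subst emeasure_PiM) (auto intro!: prod.cong)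
  also have "\<dots> = (\<Prod>j\<in>J. emeasure lborel (A j))"
    by (rule prod.reindex_bij_betw[OF p])
  finally show "emeasure (distr (\<Pi>\<^sub>M i\<in>I. lborel) (\<Pi>\<^sub>M j\<in>J. lborel) ?f) (Pi\<^sub>E J A)
      = (\<Prod>j\<in>J. emeasure lborel (A j))" .
qed simp

lemma orthonormal_basis_of_UNIV_bij:
  fixes B :: "'a::euclidean_space set"
  assumes B: "orthonormal_basis_of UNIV B"
  obtains p where "bij_betw p (Basis :: 'a set) B"
proof -
  have "independent B"
    using B unfolding orthonormal_basis_of_def
    by (metis pairwise_orthogonal_independent norm_zero zero_neq_one)
  then have "finite B" "card B = card (Basis :: 'a set)"
    using B independent_imp_finite basis_card_eq_dim[of B UNIV]
    by (auto simp: orthonormal_basis_of_def)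
  then show thesis
    using that by (metis finite_Basis finite_same_card_bij)
qed

lemma orthonormal_inner:
  assumes "orthonormal_basis_of S B" "a \<in> B" "b \<in> B"
  shows "a \<bullet> b = (if a = b then 1 else 0)"
  using assms by (auto simp: orthonormal_basis_of_def pairwise_def orthogonal_def norm_eq_1)

text \<open>A bijection from the standard basis to \<open>B\<close> extends to an orthogonal map
  \<open>T\<close>. Lebesgue measure is the image of the product measure over \<open>Basis\<close>,
  so coordinates in \<open>B\<close> yield its image under \<open>T\<close>, which is Lebesgue
  measure again.\<close>

lemma distr_PiM_orthonormal_basis:
  fixes B :: "'a::euclidean_space set"
  assumes B: "orthonormal_basis_of UNIV B"
  shows "distr (\<Pi>\<^sub>M b\<in>B. lborel) borel (\<lambda>c. \<Sum>b\<in>B. c b *\<^sub>R b) = lborel"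
proof -
  obtain p where p: "bij_betw p (Basis :: 'a set) B"
    using orthonormal_basis_of_UNIV_bij[OF B] .
  define T where "T = (\<lambda>x :: 'a. \<Sum>b\<in>Basis. (x \<bullet> b) *\<^sub>R p b)"
  have inn: "p a \<bullet> p b = (if a = b then 1 else 0)" if "a \<in> Basis" "b \<in> Basis" for a b
    using orthonormal_inner[OF B, of "p a" "p b"] p that by (auto simp: bij_betw_def inj_on_def)
  have T: "orthogonal_transformation T"
    unfolding orthogonal_transformation_def
  proof (intro conjI allI)
    show "linear T"
      unfolding T_def by (intro linearI) (auto simp: inner_add_left scaleR_add_left sum.distrib scaleR_sum_right)
    fix x y :: "'a"
    have "T x \<bullet> T y = (\<Sum>a\<in>Basis. \<Sum>b\<in>Basis. (x \<bullet> a) * (y \<bullet> b) * (p a \<bullet> p b))"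
      by (subst sum.swap) (simp add: T_def inner_sum_left inner_sum_right sum_distrib_left mult_ac)
    also have "\<dots> = (\<Sum>a\<in>Basis. (x \<bullet> a) * (y \<bullet> a))"
      by (intro sum.cong refl) (simp add: inn if_distrib cong: if_cong)
    finally show "T x \<bullet> T y = x \<bullet> y"
      by (simp add: euclidean_inner[of x y])
  qed
  have [measurable]: "T \<in> borel_measurable borel"
    by (simp add: T_def)
  have pB: "inv_into Basis p b \<in> Basis" if "b \<in> B" for b
    using p that by (auto simp: bij_betw_def inv_into_into)
  have [measurable]: "(\<lambda>x. \<lambda>j\<in>B. x (inv_into Basis p j))
      \<in> (\<Pi>\<^sub>M i\<in>Basis. lborel) \<rightarrow>\<^sub>M (\<Pi>\<^sub>M j\<in>B. (lborel :: real measure))"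
    by (intro measurable_restrict) (simp add: pB measurable_component_singleton)
  have "distr (\<Pi>\<^sub>M b\<in>B. lborel) borel (\<lambda>c. \<Sum>b\<in>B. c b *\<^sub>R b)
      = distr (\<Pi>\<^sub>M i\<in>Basis. lborel) borel (\<lambda>x. \<Sum>b\<in>B. x (inv_into Basis p b) *\<^sub>R b)"
    by (subst distr_PiM_lborel_reindex_translate[OF finite_Basis p, where c = "\<lambda>_. 0", simplified, symmetric])
       (subst distr_distr, auto simp: comp_def)
  also have "\<dots> = distr (\<Pi>\<^sub>M i\<in>Basis. lborel) borel (\<lambda>x. T (\<Sum>b\<in>Basis. x b *\<^sub>R b))"
  proof (rule arg_cong[where f = "distr _ _"], rule ext)
    fix x :: "'a \<Rightarrow> real"
    have "(\<Sum>b\<in>B. x (inv_into Basis p b) *\<^sub>R b) = (\<Sum>b\<in>Basis. x (inv_into Basis p (p b)) *\<^sub>R p b)"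
      by (rule sum.reindex_bij_betw[OF p, symmetric])
    also have "\<dots> = T (\<Sum>b\<in>Basis. x b *\<^sub>R b)"
      unfolding T_def using p
      by (intro sum.cong refl) (auto simp: bij_betw_def inner_sum_left inner_Basis if_distrib cong: if_cong)
    finally show "(\<Sum>b\<in>B. x (inv_into Basis p b) *\<^sub>R b) = T (\<Sum>b\<in>Basis. x b *\<^sub>R b)" .
  qed
  also have "\<dots> = distr lborel borel T"
    by (subst (2) lborel_eq) (subst distr_distr, auto simp: comp_def)
  also have "\<dots> = lborel"
    by (rule distr_lborel_orthogonal_transformation[OF T])
  finally show ?thesis .
qed

section \<open>Integration along hyperplanes\<close>

lemma subspace_lborel_obtain_basis:
  fixes S :: "'a::euclidean_space set"
  assumes "subspace S"
  obtains B where "orthonormal_basis_of S B" "finite B"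
    "subspace_lborel S = distr (\<Pi>\<^sub>M b\<in>B. lborel) borel (\<lambda>c. \<Sum>b\<in>B. c b *\<^sub>R b)"
proof -
  define B where "B = (SOME B. orthonormal_basis_of S B)"
  have B: "orthonormal_basis_of S B"
    unfolding B_def using orthonormal_basis_of_exists[OF assms] by (rule someI_ex)
  then have "independent B"
    unfolding orthonormal_basis_of_def
    by (metis pairwise_orthogonal_independent norm_zero zero_neq_one)
  then show thesis
    by (intro that[OF B] independent_imp_finite) (simp_all add: subspace_lborel_def B_def Let_def)
qed

lemma sets_subspace_lborel [simp, measurable_cong]: "sets (subspace_lborel S) = sets borel"
  by (simp add: subspace_lborel_def Let_def)

lemma space_subspace_lborel [simp]: "space (subspace_lborel S) = UNIV"
  by (simp add: subspace_lborel_def Let_def)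

lemma AE_subspace_lborel_mem:
  assumes S: "subspace S"
  shows "AE y in subspace_lborel S. y \<in> S"
proof -
  obtain B where B: "orthonormal_basis_of S B" "finite B"
    "subspace_lborel S = distr (\<Pi>\<^sub>M b\<in>B. lborel) borel (\<lambda>c. \<Sum>b\<in>B. c b *\<^sub>R b)"
    using subspace_lborel_obtain_basis[OF S] .
  have "(\<Sum>b\<in>B. c b *\<^sub>R b) \<in> S" for c
    using B(1) by (intro subspace_sum[OF S] subspace_scale[OF S])
      (auto simp: orthonormal_basis_of_def intro: span_base)
  moreover have "{y \<in> space borel. y \<in> S} \<in> sets borel"
    using closed_subspace[OF S] by simp
  ultimately show ?thesis
    unfolding B(3) by (subst AE_distr_iff) auto
qed

text \<open>In the coordinates of the chosen orthonormal basis, adding \<open>z\<close> shifts the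
  coordinate at \<open>b\<close> by \<open>z \<bullet> b\<close>, and the product of Lebesgue
  measures is invariant under such shifts.\<close>

lemma nn_integral_subspace_lborel_translate:
  assumes S: "subspace S" and z: "z \<in> S" and [measurable]: "g \<in> borel_measurable borel"
  shows "(\<integral>\<^sup>+ y. g (z + y) \<partial>subspace_lborel S) = (\<integral>\<^sup>+ y. g y \<partial>subspace_lborel S)"
proof -
  obtain B where B: "orthonormal_basis_of S B" "finite B"
    "subspace_lborel S = distr (\<Pi>\<^sub>M b\<in>B. lborel) borel (\<lambda>c. \<Sum>b\<in>B. c b *\<^sub>R b)"
    using subspace_lborel_obtain_basis[OF S] .
  have z: "(\<Sum>b\<in>B. (z \<bullet> b) *\<^sub>R b) = z"
    using orthonormal_basis_expand[of B z] B z by (auto simp: orthonormal_basis_of_def)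
  let ?P = "\<Pi>\<^sub>M b\<in>B. (lborel :: real measure)"
  have "distr ?P ?P (\<lambda>x. \<lambda>b\<in>B. z \<bullet> b + x b) = ?P"
    using distr_PiM_lborel_reindex_translate[OF B(2), of id B "\<lambda>b. z \<bullet> b"]
    by (simp add: inv_into_f_eq[of id] cong: restrict_cong)
  moreover have [measurable]: "(\<lambda>x. \<lambda>b\<in>B. z \<bullet> b + x b) \<in> ?P \<rightarrow>\<^sub>M ?P"
    by (intro measurable_restrict) measurable
  ultimately have "(\<integral>\<^sup>+ y. g y \<partial>subspace_lborel S)
      = (\<integral>\<^sup>+ c. g (\<Sum>b\<in>B. c b *\<^sub>R b) \<partial>distr ?P ?P (\<lambda>x. \<lambda>b\<in>B. z \<bullet> b + x b))"
    by (simp add: B(3) nn_integral_distr)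
  also have "\<dots> = (\<integral>\<^sup>+ c. g (z + (\<Sum>b\<in>B. c b *\<^sub>R b)) \<partial>?P)"
    by (simp add: nn_integral_distr scaleR_add_left sum.distrib z)
  also have "\<dots> = (\<integral>\<^sup>+ y. g (z + y) \<partial>subspace_lborel S)"
    by (simp add: B(3) nn_integral_distr)
  finally show ?thesis ..
qed

text \<open>Pulled back to coordinates, the inner integral is taken against a sigma-finite product
  measure, for which integrals depending on a parameter are measurable.\<close>

lemma borel_measurable_nn_integral_subspace_lborel:
  fixes g :: "real \<Rightarrow> 'a::euclidean_space \<Rightarrow> ennreal"
  assumes S: "subspace S" and [measurable]: "case_prod g \<in> borel_measurable (borel \<Otimes>\<^sub>M borel)"
  shows "(\<lambda>t. \<integral>\<^sup>+ y. g t y \<partial>subspace_lborel S) \<in> borel_measurable borel"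
proof -
  obtain B where B: "orthonormal_basis_of S B" "finite B"
    "subspace_lborel S = distr (\<Pi>\<^sub>M b\<in>B. lborel) borel (\<lambda>c. \<Sum>b\<in>B. c b *\<^sub>R b)"
    using subspace_lborel_obtain_basis[OF S] .
  interpret product_sigma_finite "\<lambda>_. lborel :: real measure" by standard
  interpret sigma_finite_measure "\<Pi>\<^sub>M b\<in>B. (lborel :: real measure)"
    by (rule sigma_finite[OF B(2)])
  have "(\<lambda>t. \<integral>\<^sup>+ c. g t (\<Sum>b\<in>B. c b *\<^sub>R b) \<partial>(\<Pi>\<^sub>M b\<in>B. lborel)) \<in> borel_measurable borel"
    by measurable
  then show ?thesis
    by (simp add: B(3) nn_integral_distr)
qed

section \<open>Slicing by the hyperplanes orthogonal to a unit vector\<close>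

abbreviation hyperplane_lborel :: "'a::euclidean_space \<Rightarrow> 'a measure" where
  "hyperplane_lborel v \<equiv> subspace_lborel {y. v \<bullet> y = 0}"

lemma AE_hyperplane_lborel: "AE y in hyperplane_lborel v. v \<bullet> y = 0"
  using AE_subspace_lborel_mem[OF subspace_hyperplane[of v]] by simp

lemma AE_hyperplane_lborel_inner:
  assumes "norm v = 1"
  shows "AE y in hyperplane_lborel v. (t *\<^sub>R v + y) \<bullet> v = t"
  using AE_hyperplane_lborel[of v]
  by eventually_elim (use assms in \<open>simp add: inner_add_left inner_add_right norm_eq_1 inner_commute\<close>)

text \<open>Adjoining \<open>v\<close> to an orthonormal basis of its orthogonal hyperplane gives an
  orthonormal basis of the whole space; Tonelli's theorem then splits off the coordinate along
  \<open>v\<close>.\<close>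

lemma nn_integral_lborel_hyperplanes:
  fixes g :: "'a::euclidean_space \<Rightarrow> ennreal"
  assumes v: "norm v = 1" and [measurable]: "g \<in> borel_measurable borel"
  shows "(\<integral>\<^sup>+ x. g x \<partial>lborel)
    = (\<integral>\<^sup>+ t. (\<integral>\<^sup>+ y. g (t *\<^sub>R v + y) \<partial>hyperplane_lborel v) \<partial>lborel)"
proof -
  obtain B where B: "orthonormal_basis_of {y. v \<bullet> y = 0} B" "finite B"
    "hyperplane_lborel v = distr (\<Pi>\<^sub>M b\<in>B. lborel) borel (\<lambda>c. \<Sum>b\<in>B. c b *\<^sub>R b)"
    using subspace_lborel_obtain_basis[OF subspace_hyperplane] .
  interpret product_sigma_finite "\<lambda>_. lborel :: real measure" by standard
  have vv: "v \<bullet> v = 1"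
    using v by (simp add: norm_eq_1)
  have vB: "v \<bullet> b = 0" if "b \<in> B" for b
    using B(1) that span_base[of b B] by (auto simp: orthonormal_basis_of_def)
  then have notin: "v \<notin> B"
    using vv by force
  have "x \<in> span (insert v B)" for x
  proof -
    have "x - (x \<bullet> v) *\<^sub>R v \<in> span B"
      using B(1) vv by (simp add: orthonormal_basis_of_def inner_diff_right inner_commute)
    then show ?thesis
      by (auto simp: span_insert)
  qed
  then have "orthonormal_basis_of UNIV (insert v B)"
    using B(1) v vB notin
    by (auto simp: orthonormal_basis_of_def pairwise_insert orthogonal_def inner_commute)
  then have lb: "lborel = distr (\<Pi>\<^sub>M b\<in>insert v B. lborel) borel (\<lambda>c. \<Sum>b\<in>insert v B. c b *\<^sub>R b)"
    by (rule distr_PiM_orthonormal_basis[symmetric])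
  have sum_upd: "(\<Sum>b\<in>B. (x(v := t)) b *\<^sub>R b) = (\<Sum>b\<in>B. x b *\<^sub>R b)" for x t
    using notin by (intro sum.cong) auto
  have "(\<integral>\<^sup>+ x. g x \<partial>lborel)
      = (\<integral>\<^sup>+ c. g (\<Sum>b\<in>insert v B. c b *\<^sub>R b) \<partial>(\<Pi>\<^sub>M b\<in>insert v B. lborel))"
    by (subst lb) (simp add: nn_integral_distr)
  also have "\<dots> = (\<integral>\<^sup>+ t. (\<integral>\<^sup>+ c. g (t *\<^sub>R v + (\<Sum>b\<in>B. c b *\<^sub>R b)) \<partial>(\<Pi>\<^sub>M b\<in>B. lborel)) \<partial>lborel)"
    by (subst product_nn_integral_insert_rev[OF B(2) notin])
       (use B(2) notin sum_upd in simp_all)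
  also have "\<dots> = (\<integral>\<^sup>+ t. (\<integral>\<^sup>+ y. g (t *\<^sub>R v + y) \<partial>hyperplane_lborel v) \<partial>lborel)"
    by (simp add: B(3) nn_integral_distr)
  finally show ?thesis .
qed

text \<open>The two base points differ by a vector of the hyperplane. Hence a hyperplane integral
  depends on its base point only through the level \<open>x \<bullet> v\<close>.\<close>

lemma nn_integral_hyperplane_lborel_shift:
  fixes g :: "'a::euclidean_space \<Rightarrow> ennreal"
  assumes v: "norm v = 1" and [measurable]: "g \<in> borel_measurable borel"
  shows "(\<integral>\<^sup>+ y. g (x + y) \<partial>hyperplane_lborel v)
    = (\<integral>\<^sup>+ y. g ((x \<bullet> v) *\<^sub>R v + y) \<partial>hyperplane_lborel v)"
proof -
  have "x - (x \<bullet> v) *\<^sub>R v \<in> {y. v \<bullet> y = 0}"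
    using v by (simp add: norm_eq_1 inner_diff_right inner_commute)
  from nn_integral_subspace_lborel_translate[OF subspace_hyperplane this,
      of "\<lambda>y. g ((x \<bullet> v) *\<^sub>R v + y)"]
  show ?thesis
    by (simp add: add.assoc[symmetric])
qed

lemma borel_measurable_hyperplane_lborel [measurable]:
  fixes g :: "'a::euclidean_space \<Rightarrow> ennreal"
  assumes [measurable]: "g \<in> borel_measurable borel"
  shows "(\<lambda>t. \<integral>\<^sup>+ y. g (t *\<^sub>R v + y) \<partial>hyperplane_lborel v) \<in> borel_measurable borel"
  by (intro borel_measurable_nn_integral_subspace_lborel subspace_hyperplane) measurable

text \<open>This permits replacing a density by an almost everywhere equal one inside its hyperplane
  integrals. By slicing, a null set \<open>N\<close> has null slices at almost every level
  \<open>t\<close>.\<close>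

lemma AE_lborel_AE_hyperplane:
  fixes P :: "'a::euclidean_space \<Rightarrow> bool"
  assumes v: "norm v = 1" and P: "AE x in lborel. P x"
  shows "AE x in lborel. AE y in hyperplane_lborel v. P (x + y)"
proof -
  obtain N where N: "{x. \<not> P x} \<subseteq> N" "emeasure lborel N = 0" and [measurable]: "N \<in> sets borel"
    using P by (auto elim!: AE_E)
  define \<phi> where "\<phi> t = (\<integral>\<^sup>+ y. indicator N (t *\<^sub>R v + y) \<partial>hyperplane_lborel v :: ennreal)" for t
  have [measurable]: "\<phi> \<in> borel_measurable borel"
    unfolding \<phi>_def by measurable
  have "(\<integral>\<^sup>+ t. \<phi> t \<partial>lborel) = 0"
    using nn_integral_lborel_hyperplanes[OF v, of "indicator N"] N by (simp add: \<phi>_def)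
  then have \<phi>0: "AE t in lborel. \<phi> t = 0"
    by (subst (asm) nn_integral_0_iff_AE) simp_all
  \<comment> \<open>A second slicing passes from levels to points: the points whose level has a
    non-null slice of \<open>N\<close> form a union of hyperplanes over a null set of
    levels.\<close>
  have "(\<integral>\<^sup>+ x. indicator {t. \<phi> t \<noteq> 0} (x \<bullet> v) \<partial>lborel)
      = (\<integral>\<^sup>+ t. (\<integral>\<^sup>+ y. indicator {t. \<phi> t \<noteq> 0} ((t *\<^sub>R v + y) \<bullet> v) \<partial>hyperplane_lborel v) \<partial>lborel)"
    by (rule nn_integral_lborel_hyperplanes[OF v]) measurable
  also have "\<dots> = (\<integral>\<^sup>+ t. 0 \<partial>(lborel :: real measure))"
  proof (rule nn_integral_cong_AE, use \<phi>0 in eventually_elim)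
    case (elim t)
    have "AE y in hyperplane_lborel v. indicator {t. \<phi> t \<noteq> 0} ((t *\<^sub>R v + y) \<bullet> v) = (0 :: ennreal)"
      using AE_hyperplane_lborel_inner[OF v, of t] by eventually_elim (use elim in simp)
    then show ?case
      by (subst nn_integral_0_iff_AE) simp_all
  qed
  finally have "AE x in lborel. indicator {t. \<phi> t \<noteq> 0} (x \<bullet> v) = (0 :: ennreal)"
    by (simp add: nn_integral_0_iff_AE)
  then show ?thesis
  proof eventually_elim
    case (elim x)
    have "(\<integral>\<^sup>+ y. indicator N (x + y) \<partial>hyperplane_lborel v :: ennreal) = 0"
      using elim nn_integral_hyperplane_lborel_shift[OF v, of "indicator N" x]
      by (simp add: \<phi>_def indicator_eq_0_iff)
    then have "AE y in hyperplane_lborel v. indicator N (x + y) = (0 :: ennreal)"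
      by (subst (asm) nn_integral_0_iff_AE) simp_all
    then show ?case
      by eventually_elim (use N(1) in \<open>auto simp: indicator_def split: if_splits\<close>)
  qed
qed

lemma hyperplane_lborel_ball_pos:
  fixes v :: "'a::euclidean_space"
  assumes v: "norm v = 1" and q: "v \<bullet> q = 0" and e: "0 < e"
  shows "emeasure (hyperplane_lborel v) (ball q e) \<noteq> 0"
proof
  assume "emeasure (hyperplane_lborel v) (ball q e) = 0"
  moreover have "(\<integral>\<^sup>+ y. indicator (ball q e) (q + y) \<partial>hyperplane_lborel v)
      = emeasure (hyperplane_lborel v) (ball q e)"
    using q by (subst nn_integral_subspace_lborel_translate[OF subspace_hyperplane])
      (simp_all add: borel_measurable_indicator)
  moreover have "indicator (ball q e) (q + y) = (indicator (ball 0 e) y :: ennreal)" for y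
    by (simp add: indicator_def dist_norm)
  \<comment> \<open>The slices of a ball around the origin are contained in its central slice, up to translation
    along \<open>v\<close>; so a null central slice would make the whole ball null.\<close>
  ultimately have "emeasure (hyperplane_lborel v) (ball 0 e) = 0"
    by simp
  then have "AE y in hyperplane_lborel v. y \<notin> ball 0 e"
    by (intro AE_not_in) (simp add: null_sets_def)
  then have "AE y in hyperplane_lborel v. indicator (ball 0 e) (t *\<^sub>R v + y) = (0 :: ennreal)" for t
    using AE_hyperplane_lborel[of v]
  proof eventually_elim
    case (elim y)
    have "(norm (t *\<^sub>R v + y))\<^sup>2 = (norm (t *\<^sub>R v))\<^sup>2 + (norm y)\<^sup>2"
      using elim by (intro norm_add_Pythagorean) (simp add: orthogonal_def)
    then have "norm y \<le> norm (t *\<^sub>R v + y)"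
      by (intro power2_le_imp_le[OF _ norm_ge_zero]) simp_all
    with elim show ?case
      by (simp add: indicator_def)
  qed
  then have "(\<integral>\<^sup>+ y. indicator (ball 0 e) (t *\<^sub>R v + y) \<partial>hyperplane_lborel v :: ennreal) = 0" for t
    using nn_integral_cong_AE by fastforce
  then have "emeasure lborel (ball (0 :: 'a) e) = 0"
    using nn_integral_lborel_hyperplanes[OF v, of "indicator (ball 0 e)"]
    by (simp add: borel_measurable_indicator)
  with e show False
    using open_not_negligible[of "ball (0 :: 'a) e"]
    by (auto simp: negligible_iff_null_sets null_sets_def)
qed

text \<open>As \<open>g\<close> is positive exactly on \<open>K\<close>, its integral over a
  hyperplane vanishes iff almost every point of the hyperplane avoids \<open>K\<close>. A ball in
  \<open>K\<close> around an interior point rules this out. Positivity is claimed at levels of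
  interior points only, since a supporting hyperplane may meet \<open>K\<close> in a null
  set.\<close>

lemma
  fixes g :: "'a::euclidean_space \<Rightarrow> real"
  assumes v: "norm v = 1" and K: "convex_body K" and [measurable]: "g \<in> borel_measurable borel"
    and g: "\<And>x. 0 < g x \<longleftrightarrow> x \<in> K"
  shows hyperplane_integral_eq_0: "\<lbrakk>\<And>x. x \<in> K \<Longrightarrow> x \<bullet> v \<noteq> t\<rbrakk> \<Longrightarrow> hyperplane_integral g v (t *\<^sub>R v) = 0"
    and hyperplane_integral_pos: "\<lbrakk>p \<in> interior K; p \<bullet> v = t\<rbrakk> \<Longrightarrow> 0 < hyperplane_integral g v (t *\<^sub>R v)"
proof -
  have iff: "hyperplane_integral g v (t *\<^sub>R v) = 0
      \<longleftrightarrow> (AE y in hyperplane_lborel v. t *\<^sub>R v + y \<notin> K)"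
    unfolding hyperplane_integral_def
    by (subst nn_integral_0_iff_AE) (simp_all add: g[symmetric] not_less ennreal_eq_0_iff)
  show "hyperplane_integral g v (t *\<^sub>R v) = 0" if "\<And>x. x \<in> K \<Longrightarrow> x \<bullet> v \<noteq> t"
    unfolding iff using AE_hyperplane_lborel_inner[OF v, of t] by eventually_elim (use that in auto)
  show "0 < hyperplane_integral g v (t *\<^sub>R v)" if p: "p \<in> interior K" "p \<bullet> v = t"
  proof (rule ccontr)
    assume "\<not> 0 < hyperplane_integral g v (t *\<^sub>R v)"
    then have ae: "AE y in hyperplane_lborel v. t *\<^sub>R v + y \<notin> K"
      using iff by (simp add: not_gr_zero)
    obtain e where e: "0 < e" "ball p e \<subseteq> K"
      using p by (auto simp: mem_interior)
    have "AE y in hyperplane_lborel v. y \<notin> ball (p - t *\<^sub>R v) e"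
      using ae
    proof eventually_elim
      case (elim y)
      then have "t *\<^sub>R v + y \<notin> ball p e"
        using e by blast
      then show ?case
        by (simp add: dist_norm algebra_simps)
    qed
    then have "emeasure (hyperplane_lborel v) (ball (p - t *\<^sub>R v) e) = 0"
      by (subst (asm) AE_iff_null_sets[symmetric]) auto
    moreover have "v \<bullet> (p - t *\<^sub>R v) = 0"
      using p v by (simp add: inner_diff_right inner_commute norm_eq_1)
    ultimately show False
      using hyperplane_lborel_ball_pos[OF v _ e(1)] by blast
  qed
qed

lemma nn_integral_inverse_hyperplane_integral:
  fixes g :: "'a::euclidean_space \<Rightarrow> real"
  assumes v: "norm v = 1" and [measurable]: "g \<in> borel_measurable borel"
    and fin: "(\<integral>\<^sup>+ x. ennreal (g x) \<partial>lborel) \<noteq> \<infinity>"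
  shows "(\<integral>\<^sup>+ x. inverse (hyperplane_integral g v x) * ennreal (g x) \<partial>lborel)
    = emeasure lborel {t. 0 < hyperplane_integral g v (t *\<^sub>R v)}"
proof -
  define \<phi> where "\<phi> t = hyperplane_integral g v (t *\<^sub>R v)" for t
  have \<phi>: "\<phi> t = (\<integral>\<^sup>+ y. ennreal (g (t *\<^sub>R v + y)) \<partial>hyperplane_lborel v)" for t
    by (simp add: \<phi>_def hyperplane_integral_def)
  have [measurable]: "\<phi> \<in> borel_measurable borel"
    unfolding \<phi> by (rule borel_measurable_hyperplane_lborel[of "\<lambda>x. ennreal (g x)"]) measurable
  have shift: "hyperplane_integral g v x = \<phi> (x \<bullet> v)" for x
    unfolding \<phi> hyperplane_integral_def
    by (rule nn_integral_hyperplane_lborel_shift[OF v, of "\<lambda>x. ennreal (g x)"]) measurable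
  have "(\<integral>\<^sup>+ t. \<phi> t \<partial>lborel) \<noteq> \<infinity>"
    using fin nn_integral_lborel_hyperplanes[OF v, of "\<lambda>x. ennreal (g x)"] by (simp add: \<phi>)
  then have \<phi>_fin: "AE t in lborel. \<phi> t \<noteq> \<infinity>"
    by (intro nn_integral_PInf_AE) simp_all
  have "(\<integral>\<^sup>+ x. inverse (hyperplane_integral g v x) * ennreal (g x) \<partial>lborel)
      = (\<integral>\<^sup>+ t. (\<integral>\<^sup>+ y. inverse (\<phi> ((t *\<^sub>R v + y) \<bullet> v)) * ennreal (g (t *\<^sub>R v + y)) \<partial>hyperplane_lborel v) \<partial>lborel)"
    unfolding shift by (rule nn_integral_lborel_hyperplanes[OF v]) measurable
  also have "\<dots> = (\<integral>\<^sup>+ t. (\<integral>\<^sup>+ y. inverse (\<phi> t) * ennreal (g (t *\<^sub>R v + y)) \<partial>hyperplane_lborel v) \<partial>lborel)"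
  proof (rule nn_integral_cong, rule nn_integral_cong_AE)
    fix t
    show "AE y in hyperplane_lborel v. inverse (\<phi> ((t *\<^sub>R v + y) \<bullet> v)) * ennreal (g (t *\<^sub>R v + y))
        = inverse (\<phi> t) * ennreal (g (t *\<^sub>R v + y))"
      using AE_hyperplane_lborel_inner[OF v, of t] by eventually_elim simp
  qed
  also have "\<dots> = (\<integral>\<^sup>+ t. inverse (\<phi> t) * \<phi> t \<partial>lborel)"
    by (simp add: nn_integral_cmult \<phi>)
  \<comment> \<open>At \<open>\<phi> t = 0\<close> the product is
    \<open>\<infinity> * 0 = 0\<close>, as the indicator demands. At
    \<open>\<phi> t = \<infinity>\<close> it would be \<open>0\<close> instead of \<open>1\<close>;
    integrability of \<open>g\<close> excludes this for almost every \<open>t\<close>.\<close>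
  also have "\<dots> = (\<integral>\<^sup>+ t. indicator {t. 0 < \<phi> t} t \<partial>lborel)"
  proof (rule nn_integral_cong_AE, use \<phi>_fin in eventually_elim)
    case (elim t)
    then show ?case
      by (cases "\<phi> t") (auto simp: indicator_def inverse_ennreal simp flip: ennreal_mult)
  qed
  also have "\<dots> = emeasure lborel {t. 0 < \<phi> t}"
    by simp
  finally show ?thesis
    by (simp add: \<phi>_def)
qed

section \<open>Widths of symmetric convex bodies\<close>

text \<open>The interior is convex and inherits the symmetry, so it contains the midpoint of an
  interior point and its negative.\<close>

lemma interior_symmetric_convex_body:
  assumes "convex_body K" "symmetric_set K"
  shows "0 \<in> interior K"
proof -
  obtain a where a: "a \<in> interior K"
    using assms by (auto simp: convex_body_def)
  moreover from a have "- a \<in> uminus ` interior K"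
    by (rule imageI)
  then have "- a \<in> interior K"
    using assms interior_negations[of K] unfolding symmetric_set_def by metis
  ultimately show ?thesis
    using convexD[OF convex_interior, of K a "- a" "1/2" "1/2"] assms
    by (simp add: convex_body_def)
qed

text \<open>A segment from an interior point of a convex set to another of its points is interior
  except possibly at the far end. Here the interior point is the origin.\<close>

lemma interior_convex_body_scale:
  assumes "convex_body K" "0 \<in> interior K" "x \<in> K" "0 \<le> c" "c < 1"
  shows "c *\<^sub>R x \<in> interior K"
  using mem_interior_closure_convex_shrink[of K 0 x "1 - c"] assms closure_subset[of K]
  by (auto simp: convex_body_def algebra_simps)

text \<open>The set of levels with positive integral is squeezed between the open and the closed
  interval with endpoints \<open>- h\<close> and \<open>h\<close>, where
  \<open>h = a \<bullet> v\<close> is the support function of \<open>K\<close> at \<open>v\<close>;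
  the two endpoints do not affect its length.\<close>

lemma nn_integral_inverse_hyperplane_integral_convex_body:
  fixes g :: "'a::euclidean_space \<Rightarrow> real"
  assumes v: "norm v = 1" and K: "convex_body K" "symmetric_set K"
    and [measurable]: "g \<in> borel_measurable borel"
    and fin: "(\<integral>\<^sup>+ x. ennreal (g x) \<partial>lborel) \<noteq> \<infinity>"
    and g: "\<And>x. 0 < g x \<longleftrightarrow> x \<in> K"
    and a: "a \<in> K" and max: "\<And>x. x \<in> K \<Longrightarrow> x \<bullet> v \<le> a \<bullet> v"
  shows "(\<integral>\<^sup>+ x. inverse (hyperplane_integral g v x) * ennreal (g x) \<partial>lborel) = ennreal (2 * (a \<bullet> v))"
proof -
  define h where "h = a \<bullet> v"
  have neg: "- x \<in> K" if "x \<in> K" for x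
    using K that by (force simp: symmetric_set_def)
  have 0: "0 \<in> interior K"
    by (rule interior_symmetric_convex_body[OF K])
  then have "0 \<in> K"
    using interior_subset by blast
  then have "0 \<le> h"
    using max[of 0] by (simp add: h_def)
  have pos: "0 < hyperplane_integral g v (t *\<^sub>R v)" if t: "\<bar>t\<bar> < h" for t
  proof -
    \<comment> \<open>The sign is chosen so that scaling \<open>b\<close> by
      \<open>\<bar>t\<bar> / h < 1\<close> gives an interior point exactly at level
      \<open>t\<close>.\<close>
    define b where "b = (if 0 \<le> t then a else - a)"
    have b: "b \<in> K"
      using a neg[OF a] by (simp add: b_def)
    have bv: "b \<bullet> v = (if 0 \<le> t then h else - h)"
      by (simp add: b_def h_def)
    have "(\<bar>t\<bar> / h) *\<^sub>R b \<in> interior K"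
      using t b by (intro interior_convex_body_scale[OF K(1) 0]) auto
    moreover have "((\<bar>t\<bar> / h) *\<^sub>R b) \<bullet> v = t"
      using t by (simp add: bv)
    ultimately show ?thesis
      by (rule hyperplane_integral_pos[OF v K(1) assms(4) g])
  qed
  have zero: "hyperplane_integral g v (t *\<^sub>R v) = 0" if t: "h < \<bar>t\<bar>" for t
  proof (rule hyperplane_integral_eq_0[OF v K(1) _ g])
    fix x assume "x \<in> K"
    then show "x \<bullet> v \<noteq> t"
      using max[of x] max[of "- x"] neg[of x] t by (auto simp: h_def)
  qed simp
  have "emeasure lborel {t. 0 < hyperplane_integral g v (t *\<^sub>R v)} = emeasure lborel {-h<..<h}"
  proof (rule emeasure_eq_AE)
    have "AE t in lborel. t \<noteq> h \<and> t \<noteq> - h"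
      using AE_lborel_singleton[of h] AE_lborel_singleton[of "- h"] by eventually_elim auto
    then show "AE t in lborel. t \<in> {t. 0 < hyperplane_integral g v (t *\<^sub>R v)} \<longleftrightarrow> t \<in> {-h<..<h}"
    proof eventually_elim
      case (elim t)
      then show ?case
        using pos[of t] zero[of t] by (cases "\<bar>t\<bar> < h") (auto simp: abs_less_iff)
    qed
    show "{t. 0 < hyperplane_integral g v (t *\<^sub>R v)} \<in> sets lborel"
      using borel_measurable_hyperplane_lborel[of "\<lambda>x. ennreal (g x)" v]
      unfolding hyperplane_integral_def by measurable
  qed simp
  also have "\<dots> = ennreal (2 * h)"
    using \<open>0 \<le> h\<close> by simp
  finally show ?thesis
    using nn_integral_inverse_hyperplane_integral[OF v _ fin] by (simp add: h_def)
qed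

section \<open>Radial sets, polars and the cross-section body\<close>

lemma radial_set_eqI:
  fixes L :: "'a::euclidean_space set"
  assumes "\<And>v r. norm v = 1 \<Longrightarrow> 0 \<le> r \<Longrightarrow> ennreal r \<le> \<rho> v \<longleftrightarrow> r *\<^sub>R v \<in> L"
  shows "radial_set \<rho> = L"
proof -
  have "\<exists>r v. y = r *\<^sub>R v \<and> norm v = 1 \<and> 0 \<le> r" for y :: 'a
  proof (cases "y = 0")
    case True
    \<comment> \<open>The origin lies on every ray, so any unit vector represents it with
      \<open>r = 0\<close>.\<close>
    obtain b :: 'a where "b \<in> Basis"
      using nonempty_Basis by blast
    then show ?thesis
      using True by (intro exI[of _ 0] exI[of _ b]) simp
  next
    case False
    then show ?thesis
      by (intro exI[of _ "norm y"] exI[of _ "y /\<^sub>R norm y"]) simp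
  qed
  then show ?thesis
    unfolding radial_set_def using assms by (auto; metis)
qed

lemma polar_iff: "y \<in> polar L \<longleftrightarrow> (\<forall>x\<in>L. x \<bullet> y \<le> 1)"
  by (simp add: polar_def)

text \<open>A Borel version lets the slicing results apply, and having positivity match membership
  in \<open>K\<close> at every point, not just almost everywhere, gives control of each single
  hyperplane.\<close>

lemma density_support_borel_version:
  fixes f :: "'a::euclidean_space \<Rightarrow> real"
  assumes f: "f \<in> borel_measurable lebesgue" "density_support f K" and K: "closed K"
  obtains g where "g \<in> borel_measurable borel" "AE x in lborel. f x = g x"
    "\<And>x. 0 < g x \<longleftrightarrow> x \<in> K"
proof -
  obtain g\<^sub>0 where [measurable]: "g\<^sub>0 \<in> borel_measurable borel" and g\<^sub>0: "AE x in lborel. f x = g\<^sub>0 x"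
    using completion_ex_borel_measurable_real[OF f(1)] by auto
  \<comment> \<open>The value \<open>1\<close> is an arbitrary positive number; it is used only on a
    null subset of \<open>K\<close>, since \<open>f\<close> is positive almost everywhere
    there.\<close>
  define g where "g x = (if x \<in> K then if 0 < g\<^sub>0 x then g\<^sub>0 x else 1 else 0)" for x
  have [measurable]: "K \<in> sets borel"
    using K by simp
  have "g \<in> borel_measurable borel"
    unfolding g_def by measurable
  moreover have "AE x in lborel. f x = g x"
    using g\<^sub>0 f(2)[unfolded density_support_def AE_completion_iff] by (auto simp: g_def)
  moreover have "0 < g x \<longleftrightarrow> x \<in> K" for x
    by (simp add: g_def)
  ultimately show thesis
    using that by blast
qed

text \<open>For exponent \<open>- 1\<close> both powers are inverses, so the radial function at
  \<open>v\<close> is the inverse of twice the support function of \<open>K\<close>, which is the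
  radial function of the polar of \<open>2K\<close>.\<close>

lemma cross_section_body_minus_one:
  fixes K :: "'a::euclidean_space set"
  assumes K: "convex_body K" "symmetric_set K"
    and f: "probability_density f" "density_support f K"
  shows "cross_section_body (- 1) f = polar ((\<lambda>x. 2 *\<^sub>R x) ` K)"
  unfolding cross_section_body_def
proof (rule radial_set_eqI)
  fix v :: 'a and r :: real assume v: "norm v = 1" and r: "0 \<le> r"
  obtain g where [measurable]: "g \<in> borel_measurable borel" and fg: "AE x in lborel. f x = g x"
    and g: "\<And>x. 0 < g x \<longleftrightarrow> x \<in> K"
    using density_support_borel_version[of f K] K f
    by (auto simp: probability_density_def convex_body_def compact_imp_closed)
  have "AE x in lborel. hyperplane_integral f v x = hyperplane_integral g v x"
    using AE_lborel_AE_hyperplane[OF v fg]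
    unfolding hyperplane_integral_def by eventually_elim (auto intro: nn_integral_cong_AE)
  then have "(\<integral>\<^sup>+ x. inverse (hyperplane_integral f v x) * ennreal (f x) \<partial>lebesgue)
      = (\<integral>\<^sup>+ x. inverse (hyperplane_integral g v x) * ennreal (g x) \<partial>lborel)"
    unfolding nn_integral_completion using fg by (intro nn_integral_cong_AE) auto
  moreover have "(\<integral>\<^sup>+ x. ennreal (g x) \<partial>lborel) = (\<integral>\<^sup>+ x. ennreal (f x) \<partial>lebesgue)"
    unfolding nn_integral_completion using fg by (intro nn_integral_cong_AE) auto
  then have "(\<integral>\<^sup>+ x. ennreal (g x) \<partial>lborel) \<noteq> \<infinity>"
    using f by (simp add: probability_density_def)
  moreover have 0: "0 \<in> K"
    using interior_symmetric_convex_body[OF K] interior_subset by blast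
  then obtain a where a: "a \<in> K" "\<And>x. x \<in> K \<Longrightarrow> x \<bullet> v \<le> a \<bullet> v"
    using continuous_attains_sup[of K "\<lambda>x. x \<bullet> v"] K
    by (force simp: convex_body_def intro: continuous_on_inner continuous_on_id continuous_on_const)
  ultimately have I: "(\<integral>\<^sup>+ x. inverse (hyperplane_integral f v x) * ennreal (f x) \<partial>lebesgue)
      = ennreal (2 * (a \<bullet> v))"
    using nn_integral_inverse_hyperplane_integral_convex_body[OF v K _ _ g a] by simp
  have "0 \<le> a \<bullet> v"
    using a(2)[OF 0] by simp
  \<comment> \<open>If \<open>a \<bullet> v = 0\<close>, the inverse is infinite and both sides
    hold.\<close>
  then have "ennreal r \<le> inverse (ennreal (2 * (a \<bullet> v))) \<longleftrightarrow> 2 * (r * (a \<bullet> v)) \<le> 1"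
    using r by (cases "a \<bullet> v = 0") (simp_all add: inverse_ennreal field_simps)
  \<comment> \<open>Because \<open>r\<close> is nonnegative, the constraint at the maximiser
    \<open>a\<close> implies those at all other points of \<open>K\<close>.\<close>
  also have "\<dots> \<longleftrightarrow> r *\<^sub>R v \<in> polar ((\<lambda>x. 2 *\<^sub>R x) ` K)"
  proof
    assume le: "2 * (r * (a \<bullet> v)) \<le> 1"
    have "r * (2 * (x \<bullet> v)) \<le> 1" if "x \<in> K" for x
      using mult_left_mono[OF a(2)[OF that] r] le by linarith
    then show "r *\<^sub>R v \<in> polar ((\<lambda>x. 2 *\<^sub>R x) ` K)"
      by (simp add: polar_iff)
  qed (use a in \<open>simp add: polar_iff mult.left_commute\<close>)
  finally show "ennreal r \<le> ennpow (\<integral>\<^sup>+ x. ennpow (hyperplane_integral f v x) (- 1) * ennreal (f x) \<partial>lebesgue) (1 / - 1)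
      \<longleftrightarrow> r *\<^sub>R v \<in> polar ((\<lambda>x. 2 *\<^sub>R x) ` K)"
    by (simp add: ennpow_minus_one I)
qed

section \<open>Chord lengths\<close>

text \<open>For each fixed \<open>r\<close> the exceptional points form a translate of a null set;
  integrating over \<open>r\<close> last gives the claim. The case \<open>v = 0\<close> covers
  properties of the first coordinate alone.\<close>

lemma AE_lborel_line_shift:
  fixes v :: "'a::euclidean_space"
  assumes "AE x in lborel. P x"
  shows "AE (x, r) in lborel. P (x + r *\<^sub>R v)"
proof -
  obtain N where N: "{x. \<not> P x} \<subseteq> N" "emeasure lborel N = 0" and [measurable]: "N \<in> sets borel"
    using assms by (auto elim!: AE_E)
  have "(\<integral>\<^sup>+ z. indicator N (fst z + snd z *\<^sub>R v) \<partial>(lborel \<Otimes>\<^sub>M lborel))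
      = (\<integral>\<^sup>+ r. (\<integral>\<^sup>+ x. indicator N (x + r *\<^sub>R v) \<partial>lborel) \<partial>lborel :: ennreal)"
    by (subst lborel_pair.nn_integral_snd[symmetric]) simp_all
  also have "\<dots> = 0"
    using N(2) nn_integral_lborel_translate[of "indicator N" "_ *\<^sub>R v"] by (simp add: add.commute)
  finally have "AE z in lborel \<Otimes>\<^sub>M lborel. indicator N (fst z + snd z *\<^sub>R v) = (0 :: ennreal)"
    by (subst (asm) nn_integral_0_iff_AE) simp_all
  then have "AE z in lborel. indicator N (fst z + snd z *\<^sub>R v) = (0 :: ennreal)"
    unfolding lborel_prod .
  then show ?thesis
    by eventually_elim (use N(1) in \<open>auto simp: indicator_def split: if_splits\<close>)
qed

text \<open>A Borel map stays measurable between the completions once preimages of null sets are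
  null, which is what the preceding lemma supplies. It is applied to compositions with the Lebesgue
  measurable \<open>f\<close>.\<close>

lemma measurable_lebesgue_line_shift:
  fixes v :: "'a::euclidean_space"
  shows "(\<lambda>z. fst z + snd z *\<^sub>R v) \<in> lebesgue \<rightarrow>\<^sub>M lebesgue"
proof (rule completion.measurable_completion2)
  have [measurable]: "(\<lambda>z. fst z + snd z *\<^sub>R v) \<in> borel \<rightarrow>\<^sub>M borel"
    by (intro borel_measurable_continuous_onI continuous_intros)
  then show *: "(\<lambda>z. fst z + snd z *\<^sub>R v) \<in> lebesgue \<rightarrow>\<^sub>M lborel"
    by (intro measurable_completion) simp
  show "null_sets lborel \<subseteq> null_sets (distr lebesgue lborel (\<lambda>z. fst z + snd z *\<^sub>R v))"
  proof
    fix N :: "'a set" assume N: "N \<in> null_sets lborel"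
    then have "AE (x, r) in lborel. x + r *\<^sub>R v \<notin> N"
      by (intro AE_lborel_line_shift AE_not_in)
    then have "AE z in lebesgue. fst z + snd z *\<^sub>R v \<notin> N"
      by (simp add: AE_completion_iff case_prod_beta)
    then have "AE x in distr lebesgue lborel (\<lambda>z. fst z + snd z *\<^sub>R v). x \<notin> N"
      using N * by (subst AE_distr_iff) auto
    then show "N \<in> null_sets (distr lebesgue lborel (\<lambda>z. fst z + snd z *\<^sub>R v))"
      using N by (subst AE_iff_null_sets) auto
  qed
qed

text \<open>Almost everywhere for a measure with a density means almost everywhere where the density
  is positive. Up to a null set, \<open>f x * f (x + r *\<^sub>R v)\<close> is positive exactly when
  both ends of the chord lie in \<open>K\<close>, so the essential supremum depends on
  \<open>K\<close> alone.\<close>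

lemma AE_chord_density_iff:
  fixes f :: "'a::euclidean_space \<Rightarrow> real"
  assumes f: "f \<in> borel_measurable lebesgue" "\<And>x. 0 \<le> f x" "density_support f K"
  shows "(AE z in density (lebesgue_on (UNIV \<times> {0<..})) (\<lambda>(x, r). ennreal (f x * f (x + r *\<^sub>R v))). P z)
    \<longleftrightarrow> (AE (x, r) in lborel. 0 < r \<longrightarrow> x \<in> K \<longrightarrow> x + r *\<^sub>R v \<in> K \<longrightarrow> P (x, r))"
proof -
  have "(\<lambda>z. f (fst z + snd z *\<^sub>R w)) \<in> borel_measurable lebesgue" for w
    using measurable_compose[OF measurable_lebesgue_line_shift f(1)] .
  from this[of 0] this[of v]
  have meas: "(\<lambda>(x, r). ennreal (f x * f (x + r *\<^sub>R v))) \<in> borel_measurable lebesgue"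
    by (simp add: case_prod_beta)
  have "open (UNIV \<times> {0<..} :: ('a \<times> real) set)"
    by (intro open_Times open_UNIV open_greaterThan)
  then have S: "UNIV \<times> {0<..} \<in> sets (lebesgue :: ('a \<times> real) measure)"
    by simp
  have pos: "AE x in lborel. 0 < f x \<longleftrightarrow> x \<in> K"
    using f(3) unfolding density_support_def AE_completion_iff by auto
  have "(AE z in density (lebesgue_on (UNIV \<times> {0<..})) (\<lambda>(x, r). ennreal (f x * f (x + r *\<^sub>R v))). P z)
      \<longleftrightarrow> (AE z in lborel. z \<in> UNIV \<times> {0<..} \<longrightarrow> 0 < (case z of (x, r) \<Rightarrow> ennreal (f x * f (x + r *\<^sub>R v))) \<longrightarrow> P z)"
    using S by (simp add: AE_density[OF measurable_restrict_space1[OF meas]] AE_restrict_space_iff AE_completion_iff)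
  also have "\<dots> \<longleftrightarrow> (AE (x, r) in lborel. 0 < r \<longrightarrow> x \<in> K \<longrightarrow> x + r *\<^sub>R v \<in> K \<longrightarrow> P (x, r))"
  proof -
    have prod_pos: "0 < f x * f y \<longleftrightarrow> 0 < f x \<and> 0 < f y" for x y
      using f(2)[of x] f(2)[of y] by (auto simp: zero_less_mult_iff)
    have "AE z in lborel. (z \<in> UNIV \<times> {0<..} \<longrightarrow> 0 < (case z of (x, r) \<Rightarrow> ennreal (f x * f (x + r *\<^sub>R v))) \<longrightarrow> P z)
        \<longleftrightarrow> (case z of (x, r) \<Rightarrow> 0 < r \<longrightarrow> x \<in> K \<longrightarrow> x + r *\<^sub>R v \<in> K \<longrightarrow> P (x, r))"
      using AE_lborel_line_shift[OF pos, of 0] AE_lborel_line_shift[OF pos, of v]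
      by eventually_elim (auto simp: prod_pos)
    then show ?thesis
      by (rule eventually_subst)
  qed
  finally show ?thesis .
qed

lemma radial_mean_body_infinity_eq:
  fixes K :: "'a::euclidean_space set"
  assumes K: "convex_body K" "symmetric_set K"
    and f: "probability_density f" "density_support f K"
  shows "radial_mean_body_infinity f = (\<lambda>x. 2 *\<^sub>R x) ` K"
  unfolding radial_mean_body_infinity_def
proof (rule radial_set_eqI)
  fix v :: 'a and r :: real assume v: "norm v = 1" and r: "0 \<le> r"
  define D where "D = density (lebesgue_on (UNIV \<times> {0<..})) (\<lambda>(x, r). ennreal (f x * f (x + r *\<^sub>R v)))"
  have AE_D: "(AE z in D. P z)
      \<longleftrightarrow> (AE (x, r) in lborel. 0 < r \<longrightarrow> x \<in> K \<longrightarrow> x + r *\<^sub>R v \<in> K \<longrightarrow> P (x, r))" for P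
    unfolding D_def using f by (intro AE_chord_density_iff) (auto simp: probability_density_def)
  have "(\<lambda>(x :: 'a, r :: real). ennreal r) \<in> borel_measurable borel"
    by (simp add: case_prod_beta borel_prod[symmetric])
  then have meas: "(\<lambda>(x, r). ennreal r) \<in> borel_measurable D"
    by (simp add: D_def measurable_restrict_space1 measurable_completion)
  have cvx: "convex K" and "closed K"
    using K by (auto simp: convex_body_def compact_imp_closed)
  have neg: "- x \<in> K" if "x \<in> K" for x
    using K that by (force simp: symmetric_set_def)
  have 0: "0 \<in> interior K"
    by (rule interior_symmetric_convex_body[OF K])
  have mem: "s *\<^sub>R v \<in> (\<lambda>x. 2 *\<^sub>R x) ` K \<longleftrightarrow> (s / 2) *\<^sub>R v \<in> K" for s
  proof
    assume "(s / 2) *\<^sub>R v \<in> K"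
    then show "s *\<^sub>R v \<in> (\<lambda>x. 2 *\<^sub>R x) ` K"
      by (intro image_eqI) auto
  next
    assume "s *\<^sub>R v \<in> (\<lambda>x. 2 *\<^sub>R x) ` K"
    then obtain x where x: "x \<in> K" "s *\<^sub>R v = 2 *\<^sub>R x"
      by blast
    have "(s / 2) *\<^sub>R v = (1 / 2) *\<^sub>R s *\<^sub>R v"
      by simp
    also have "\<dots> = x"
      unfolding x(2) by simp
    finally show "(s / 2) *\<^sub>R v \<in> K"
      using x(1) by simp
  qed
  show "ennreal r \<le> esssup D (\<lambda>(x, r). ennreal r) \<longleftrightarrow> r *\<^sub>R v \<in> (\<lambda>x. 2 *\<^sub>R x) ` K"
    unfolding mem
  proof
    assume rK: "(r / 2) *\<^sub>R v \<in> K"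
    show "ennreal r \<le> esssup D (\<lambda>(x, r). ennreal r)"
    proof (rule ccontr)
      assume "\<not> ?thesis"
      then obtain c where c: "0 \<le> c" "c < r" and ess: "esssup D (\<lambda>(x, r). ennreal r) = ennreal c"
        by (cases "esssup D (\<lambda>(x, r). ennreal r)") (auto simp: not_le ennreal_less_iff)
      have "AE z in D. snd z \<le> c"
        using esssup_AE[of "\<lambda>(x, r). ennreal r" D] unfolding ess
        by eventually_elim (use c in \<open>auto simp: case_prod_beta\<close>)
      \<comment> \<open>These are the chords longer than \<open>c\<close> with both endpoints
        interior. They form an open set, which the bound \<open>c\<close> forces to be null, hence
        empty.\<close>
      define U where "U = {z. c < snd z \<and> fst z \<in> interior K \<and> fst z + snd z *\<^sub>R v \<in> interior K}"
      have "AE z in lborel. z \<notin> U"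
        using \<open>AE z in D. snd z \<le> c\<close> unfolding AE_D
        by eventually_elim (use c interior_subset[of K] in \<open>auto simp: U_def\<close>)
      moreover have "open U"
        unfolding U_def by (intro open_Collect_conj open_Collect_less continuous_intros
            open_vimage[unfolded vimage_def] open_interior)
      ultimately have "negligible U"
        by (simp add: negligible_iff_null_sets AE_iff_null_sets AE_completion_iff)
      \<comment> \<open>A length strictly between \<open>c\<close> and \<open>r\<close> keeps the
        centred chord longer than \<open>c\<close> while shrinking its endpoints into the interior,
        so it belongs to \<open>U\<close>.\<close>
      define s where "s = (c + r) / 2"
      have s: "c < s" "s < r"
        using c by (auto simp: s_def)
      have sr: "0 \<le> s / r" "s / r < 1"
        using c s by simp_all
      have half: "s *\<^sub>R v = (s / 2) *\<^sub>R v + (s / 2) *\<^sub>R v"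
        by (simp flip: scaleR_left.add)
      have "(s / 2) *\<^sub>R v \<in> interior K" "- ((s / 2) *\<^sub>R v) \<in> interior K"
        using interior_convex_body_scale[OF K(1) 0 rK sr]
          interior_convex_body_scale[OF K(1) 0 neg[OF rK] sr] c s by simp_all
      then have "(- ((s / 2) *\<^sub>R v), s) \<in> U"
        using s by (simp add: U_def half)
      then show False
        using open_not_negligible[OF \<open>open U\<close>] \<open>negligible U\<close> by blast
    qed
  next
    assume le: "ennreal r \<le> esssup D (\<lambda>(x, r). ennreal r)"
    show "(r / 2) *\<^sub>R v \<in> K"
    proof (rule ccontr)
      assume notin: "(r / 2) *\<^sub>R v \<notin> K"
      have scale: "(s / 2) *\<^sub>R v \<in> K" if "(t / 2) *\<^sub>R v \<in> K" "0 \<le> s" "s \<le> t" for s t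
      proof (cases "t = 0")
        case False
        then show ?thesis
          using convexD[OF cvx, of 0 "(t / 2) *\<^sub>R v" "1 - s / t" "s / t"] that 0 interior_subset[of K]
          by (auto simp: subset_iff)
      qed (use that in auto)
      have "open ((\<lambda>s. (s / 2) *\<^sub>R v) -` (- K))"
        using \<open>closed K\<close> by (intro open_vimage continuous_intros) auto
      then obtain e where e: "0 < e" "\<And>s. \<bar>s - r\<bar> < e \<Longrightarrow> (s / 2) *\<^sub>R v \<notin> K"
        using notin by (auto simp: open_dist dist_real_def dest!: bspec[of _ _ r])
      have "r \<noteq> 0"
        using notin 0 interior_subset[of K] by auto
      \<comment> \<open>The complement of \<open>K\<close> is open, so \<open>r\<close> can be
        lowered to some \<open>s < r\<close> with \<open>(s / 2) *\<^sub>R v\<close> still outside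
        \<open>K\<close>. The strict gap is what contradicts \<open>le\<close>; the maximum with
        \<open>0\<close> keeps \<open>s\<close> nonnegative, as \<open>ennreal s\<close> and
        \<open>scale\<close> require.\<close>
      define s where "s = max 0 (r - e / 2)"
      have s: "0 \<le> s" "s < r" "(s / 2) *\<^sub>R v \<notin> K"
        using e r \<open>r \<noteq> 0\<close> e(2)[of "r - e / 2"] scale[of r 0] by (auto simp: s_def max_def abs_if)
      have "AE z in D. (\<lambda>(x, r). ennreal r) z \<le> ennreal s"
        unfolding AE_D
      proof (rule AE_I2, clarsimp)
        fix x :: 'a and t :: real
        assume t: "0 < t" "x \<in> K" "x + t *\<^sub>R v \<in> K"
        \<comment> \<open>The midpoint of the chord's end \<open>x + t *\<^sub>R v\<close> and the
          reflection \<open>- x\<close> of its start is \<open>(t / 2) *\<^sub>R v\<close>: the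
          centred chord of the same length also lies in \<open>K\<close>.\<close>
        then have "(1 / 2) *\<^sub>R (x + t *\<^sub>R v) + (1 / 2) *\<^sub>R (- x) \<in> K"
          by (intro convexD[OF cvx] neg) auto
        then have "(t / 2) *\<^sub>R v \<in> K"
          by (simp add: algebra_simps)
        then have "t \<le> s"
          using scale[of t s] s by force
        then show "ennreal t \<le> ennreal s"
          by (rule ennreal_leI)
      qed
      then have "esssup D (\<lambda>(x, r). ennreal r) \<le> ennreal s"
        by (intro esssup_I meas)
      with le s show False
        by (auto dest: order_trans)
    qed
  qed
qed

theorem theorem3p1:
  fixes K :: "(real ^ 'n) set" and f :: "real ^ 'n \<Rightarrow> real"
  assumes "convex_body K" and "symmetric_set K"
    and "probability_density f" and "density_support f K"
  shows "cross_section_body (- 1) f = polar ((\<lambda>x. 2 *\<^sub>R x) ` K)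
    \<and> polar ((\<lambda>x. 2 *\<^sub>R x) ` K) = polar (radial_mean_body_infinity f)"
  using cross_section_body_minus_one[OF assms] radial_mean_body_infinity_eq[OF assms] by simp

end
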